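(* Let $(X,d)$ be a complete controlled rectangular metric space with control function $\alpha: X\times X\to[1,+\infty[$, and let $T:X\to X$ be a self-mapping. Suppose there exists $k\in\,]0,1[$ such that for all $x,y\in X$, $$d(Ty,Tx)>0\ \Longrightarrow\ d(Ty,Tx)\leq k\,d(x,y).$$ Let $x_0\in X$ and put $x_n=T^n x_0$ for $n\in\mathbb{N}$. Suppose that $$\lim_{i\to\infty}\ \sup_{m\geq 1}\ \alpha(x_{i+1},x_m)\,\frac{\alpha(x_{i+1},x_{i+2})+\alpha(x_{i+2},x_{i+3})}{\alpha(x_i,x_{i+1})+\alpha(x_{i+1},x_{i+2})}<\frac{1}{k^2}.$$ Assume moreover that for every $x\in X$ the limits $$\lim_{n\to+\infty}\alpha(x_n,x),\qquad \lim_{n\to+\infty}\alpha(x,x_n),\qquad \lim_{n,m\to+\infty,\ n\neq m}\alpha(x_n,x_m)$$ exist and are finite. Then $T$ has a unique fixed point in $X$.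
   Context: Let $X$ be a non-empty set and $\alpha:X\times X\to[1,+\infty[$ a function. A function $d:X\times X\to[0,+\infty[$ is called a controlled rectangular metric (with control function $\alpha$), and $(X,d)$ a controlled rectangular metric space, if: ($d_1$) for all $x,y\in X$, $d(x,y)=0$ if and only if $x=y$; ($d_2$) for all $x,y\in X$, $d(x,y)=d(y,x)$; ($d_3$) for all pairwise distinct $x,y,u,v\in X$, $d(x,y)\leq\alpha(x,u)d(x,u)+\alpha(u,v)d(u,v)+\alpha(v,y)d(v,y)$. (The function $\alpha$ is not assumed symmetric.) A sequence $\{x_n\}$ in $X$ converges to $x\in X$ if $\lim_{n\to\infty}d(x_n,x)=0$; it is Cauchy if for every $\varepsilon>0$ there is a positive integer $N$ such that $d(x_n,x_m)<\varepsilon$ for all $n,m\geq N$. The space $(X,d)$ is complete if every Cauchy sequence in $X$ converges to some point of $X$. *)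

theory Defs
  imports "HOL-Library.FuncSet" "HOL-Library.Extended_Real"
begin

text \<open>The control function \<open>\<alpha>\<close> is not assumed symmetric; nothing is required of \<open>\<alpha>\<close> and \<open>d\<close>
  outside the carrier \<open>X\<close>.\<close>

locale controlled_rectangular_metric =
  fixes X :: "'a set" and \<alpha> :: "'a \<Rightarrow> 'a \<Rightarrow> real" and d :: "'a \<Rightarrow> 'a \<Rightarrow> real"
  assumes nonempty: "X \<noteq> {}"
    and control_ge_one: "\<lbrakk>x \<in> X; y \<in> X\<rbrakk> \<Longrightarrow> 1 \<le> \<alpha> x y"
    and nonneg: "\<lbrakk>x \<in> X; y \<in> X\<rbrakk> \<Longrightarrow> 0 \<le> d x y"
    and zero_iff: "\<lbrakk>x \<in> X; y \<in> X\<rbrakk> \<Longrightarrow> d x y = 0 \<longleftrightarrow> x = y"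
    and commute: "\<lbrakk>x \<in> X; y \<in> X\<rbrakk> \<Longrightarrow> d x y = d y x"
    and rectangle: "\<lbrakk>x \<in> X; y \<in> X; u \<in> X; v \<in> X; distinct [x, y, u, v]\<rbrakk> \<Longrightarrow>
      d x y \<le> \<alpha> x u * d x u + \<alpha> u v * d u v + \<alpha> v y * d v y"

definition converges_to :: "('a \<Rightarrow> 'a \<Rightarrow> real) \<Rightarrow> (nat \<Rightarrow> 'a) \<Rightarrow> 'a \<Rightarrow> bool" where
  "converges_to d s x \<longleftrightarrow> (\<lambda>n. d (s n) x) \<longlonglongrightarrow> 0"

definition cauchy_seq :: "('a \<Rightarrow> 'a \<Rightarrow> real) \<Rightarrow> (nat \<Rightarrow> 'a) \<Rightarrow> bool" where
  "cauchy_seq d s \<longleftrightarrow> (\<forall>\<epsilon>>0. \<exists>N\<ge>1. \<forall>n\<ge>N. \<forall>m\<ge>N. d (s n) (s m) < \<epsilon>)"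

definition complete_space :: "'a set \<Rightarrow> ('a \<Rightarrow> 'a \<Rightarrow> real) \<Rightarrow> bool" where
  "complete_space X d \<longleftrightarrow>
    (\<forall>s. range s \<subseteq> X \<longrightarrow> cauchy_seq d s \<longrightarrow> (\<exists>x\<in>X. converges_to d s x))"

text \<open>The filter describing \<open>n, m \<rightarrow> \<infinity>\<close> subject to \<open>n \<noteq> m\<close>.\<close>

definition off_diagonal_at_top :: "(nat \<times> nat) filter" where
  "off_diagonal_at_top = inf (sequentially \<times>\<^sub>F sequentially) (principal {(n, m). n \<noteq> m})"

end

theory Submission
  imports Defs
begin

text \<open>
  The self-mapping is a \<open>k\<close>-contraction, so the distance between \<open>x\<^sub>n\<close> and \<open>x\<^bsub>n+p\<^esub>\<close>
  is at most \<open>k\<^sup>n d(x\<^sub>0, x\<^sub>p)\<close> for every shift \<open>p\<close>. If two of the \<open>x\<^sub>n\<close> coincide, then the orbit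
  is periodic from there on; contraction forces the period to be one, and a fixed point has been reached.

  Otherwise the orbit is injective, and the rectangle inequality applies along it. The existence of
  the double limit of \<open>\<alpha>\<close> bounds \<open>\<alpha>\<close> by some \<open>M\<close> on far-out pairs of distinct orbit points. Passing from
  \<open>x\<^sub>n\<close> to \<open>x\<^sub>m\<close> through \<open>x\<^bsub>n+p\<^esub>\<close> and \<open>x\<^bsub>m+p\<^esub>\<close> gives
  \<open>d(x\<^sub>n, x\<^sub>m) \<le> M (d(x\<^sub>n, x\<^bsub>n+p\<^esub>) + k\<^sup>p d(x\<^sub>n, x\<^sub>m) + d(x\<^bsub>m+p\<^esub>, x\<^sub>m))\<close>.
  Once \<open>p\<close> is so large that \<open>M k\<^sup>p \<le> 1/2\<close>, the middle term is absorbed by the left-hand side, and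
  what remains tends to zero: the orbit is Cauchy (\<open>contractive_imp_cauchy_seq\<close>).

  By completeness the orbit has a limit \<open>z\<close>, and by contraction it also converges to \<open>T z\<close>. In a
  rectangular space a sequence may have several limits, but not an injective one whose consecutive
  terms approach each other and along which the coefficients \<open>\<alpha>\<close> converge
  (\<open>injective_limit_unique\<close>). Hence \<open>T z = z\<close>. Two fixed points coincide because \<open>k < 1\<close>.
\<close>

section \<open>The filter of far-out distinct pairs\<close>

lemma eventually_off_diagonal_at_top:
  "eventually P off_diagonal_at_top \<longleftrightarrow> (\<exists>N. \<forall>n\<ge>N. \<forall>m\<ge>N. n \<noteq> m \<longrightarrow> P (n, m))"
  unfolding off_diagonal_at_top_def eventually_inf_principal eventually_prod_sequentially
  by auto

lemma filterlim_Suc_off_diagonal_at_top: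
  "filterlim (\<lambda>n. (n, Suc n)) off_diagonal_at_top sequentially"
  unfolding off_diagonal_at_top_def
  by (auto simp: filterlim_inf filterlim_principal filterlim_Suc
           intro!: filterlim_Pair filterlim_ident)

section \<open>Contractive sequences\<close>

context controlled_rectangular_metric
begin

lemma contractive_shift_le:
  assumes contr: "\<And>n m. d (s (Suc n)) (s (Suc m)) \<le> k * d (s n) (s m)" and "0 \<le> k"
  shows "d (s (n + i)) (s (m + i)) \<le> k ^ i * d (s n) (s m)"
proof (induction i)
  case (Suc i)
  have "d (s (n + Suc i)) (s (m + Suc i)) \<le> k * d (s (n + i)) (s (m + i))"
    using contr[of "n + i" "m + i"] by simp
  also have "\<dots> \<le> k * (k ^ i * d (s n) (s m))"
    using Suc \<open>0 \<le> k\<close> by (rule mult_left_mono)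
  finally show ?case by (simp add: mult.assoc)
qed simp

lemma contractive_gap_tendsto_0:
  assumes "range s \<subseteq> X"
    and contr: "\<And>n m. d (s (Suc n)) (s (Suc m)) \<le> k * d (s n) (s m)" and "0 \<le> k" "k < 1"
  shows "(\<lambda>n. d (s n) (s (n + p))) \<longlonglongrightarrow> 0"
proof (rule tendsto_sandwich)
  show "\<forall>\<^sub>F n in sequentially. 0 \<le> d (s n) (s (n + p))"
    using assms(1) nonneg by (auto simp: image_subset_iff)
  show "\<forall>\<^sub>F n in sequentially. d (s n) (s (n + p)) \<le> k ^ n * d (s 0) (s p)"
    using contractive_shift_le[where s = s and n = 0 and m = p, OF contr \<open>0 \<le> k\<close>]
    by (simp add: add.commute)
  show "(\<lambda>n. k ^ n * d (s 0) (s p)) \<longlonglongrightarrow> 0"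
    using assms by (intro tendsto_mult_left_zero LIMSEQ_power_zero) auto
qed simp

text \<open>A coincidence makes the sequence periodic from some index \<open>n\<close> on. The distance of the
  consecutive terms at \<open>n\<close> then recurs after every period, although contraction shrinks it.\<close>

lemma contractive_inj_or_stationary:
  assumes "range s \<subseteq> X"
    and contr: "\<And>n m. d (s (Suc n)) (s (Suc m)) \<le> k * d (s n) (s m)" and "0 \<le> k" "k < 1"
    and periodic: "\<And>n m. s n = s m \<Longrightarrow> s (Suc n) = s (Suc m)"
  shows "inj s \<or> (\<exists>n. s (Suc n) = s n)"
proof (cases "inj s")
  case False
  then obtain n m where "n < m" "s n = s m"
    by (metis injI linorder_neqE_nat)
  define p where "p = m - n"
  have p: "0 < p" "s n = s (n + p)"
    using \<open>n < m\<close> \<open>s n = s m\<close> by (simp_all add: p_def)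
  have "d (s n) (s (Suc n)) = d (s (n + p)) (s (Suc n + p))"
    using p periodic[of n "n + p"] by simp
  also have "\<dots> \<le> k ^ p * d (s n) (s (Suc n))"
    by (rule contractive_shift_le[where s = s, OF contr \<open>0 \<le> k\<close>])
  finally have le: "(1 - k ^ p) * d (s n) (s (Suc n)) \<le> 0"
    by (simp add: algebra_simps)
  have "k ^ p < 1"
    using p(1) \<open>0 \<le> k\<close> \<open>k < 1\<close> by (simp add: power_less_one_iff)
  with le have "d (s n) (s (Suc n)) \<le> 0"
    by (simp add: mult_le_0_iff)
  moreover have in_X: "s n \<in> X" "s (Suc n) \<in> X"
    using assms(1) by auto
  ultimately have "s n = s (Suc n)"
    using nonneg[OF in_X] zero_iff[OF in_X] by simp
  then show ?thesis by metis
qed simp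

text \<open>The detour from \<open>s n\<close> to \<open>s m\<close> through \<open>s (n + p)\<close> and \<open>s (m + p)\<close> bounds the distance by a
  multiple of itself plus two gaps of fixed length \<open>p\<close>. A large \<open>p\<close> makes that multiple at most
  one half.\<close>

lemma contractive_imp_cauchy_seq:
  assumes ran: "range s \<subseteq> X" and "inj s"
    and contr: "\<And>n m. d (s (Suc n)) (s (Suc m)) \<le> k * d (s n) (s m)" and "0 \<le> k" "k < 1"
    and bound: "\<And>n m. \<lbrakk>N \<le> n; N \<le> m; n \<noteq> m\<rbrakk> \<Longrightarrow> \<alpha> (s n) (s m) \<le> M"
  shows "cauchy_seq d s"
proof -
  have in_X: "s n \<in> X" for n
    using ran by auto
  have "1 \<le> M"
    using control_ge_one[OF in_X in_X, of N "Suc N"] bound[of N "Suc N"] by simp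
  have "(\<lambda>p. M * k ^ p) \<longlonglongrightarrow> 0"
    using \<open>0 \<le> k\<close> \<open>k < 1\<close> by (intro tendsto_mult_right_zero LIMSEQ_power_zero) simp
  then have "\<forall>\<^sub>F p in sequentially. M * k ^ p < 1 / 2"
    by (rule order_tendstoD) simp
  then have "\<forall>\<^sub>F p in sequentially. 0 < p \<and> M * k ^ p < 1 / 2"
    using eventually_gt_at_top[of "0 :: nat"] by eventually_elim simp
  then obtain p where "0 < p" and p: "M * k ^ p < 1 / 2"
    by (auto dest: eventually_happens)
  define g where "g n = d (s n) (s (n + p))" for n
  have g_nonneg: "0 \<le> g n" for n
    unfolding g_def by (intro nonneg in_X)
  have weight: "\<alpha> (s i) (s j) * d (s i) (s j) \<le> M * d (s i) (s j)"
    if "N \<le> i" "N \<le> j" "i \<noteq> j" for i j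
    using bound[OF that] nonneg[OF in_X in_X] by (rule mult_right_mono)

  have close: "d (s n) (s m) \<le> 2 * M * (g n + g m)" if "N \<le> n" "N \<le> m" for n m
  proof -
    have le_self: "t \<le> 2 * M * t" if "0 \<le> t" for t
      using mult_right_mono[of 1 "2 * M" t] that \<open>1 \<le> M\<close> by simp
    \<comment> \<open>For indices that agree or differ by \<open>p\<close> the four corners of the detour are not
      distinct, but then the distance is zero or itself a gap of length \<open>p\<close>.\<close>
    consider "n = m" | "m = n + p" | "n = m + p" | "n \<noteq> m" "m \<noteq> n + p" "n \<noteq> m + p"
      by blast
    then show ?thesis
    proof cases
      case 1
      then show ?thesis
        using zero_iff[OF in_X in_X, of m m] g_nonneg[of m] \<open>1 \<le> M\<close> by simp
    next
      case 2
      then have "d (s n) (s m) \<le> g n + g m"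
        using g_nonneg[of m] by (simp add: g_def)
      then show ?thesis
        using le_self[of "g n + g m"] g_nonneg[of n] g_nonneg[of m] by linarith
    next
      case 3
      then have "d (s n) (s m) \<le> g n + g m"
        using g_nonneg[of n] commute[OF in_X in_X, of n m] by (simp add: g_def)
      then show ?thesis
        using le_self[of "g n + g m"] g_nonneg[of n] g_nonneg[of m] by linarith
    next
      case 4
      have "d (s n) (s m) \<le> \<alpha> (s n) (s (n + p)) * d (s n) (s (n + p))
          + \<alpha> (s (n + p)) (s (m + p)) * d (s (n + p)) (s (m + p))
          + \<alpha> (s (m + p)) (s m) * d (s (m + p)) (s m)"
        using 4 \<open>0 < p\<close> \<open>inj s\<close> by (intro rectangle in_X) (auto simp: inj_eq)
      also have "\<dots> \<le> M * g n + M * d (s (n + p)) (s (m + p)) + M * g m"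
        using weight[of n "n + p"] weight[of "n + p" "m + p"] weight[of "m + p" m]
          that 4(1) \<open>0 < p\<close> commute[OF in_X in_X, of "m + p" m]
        by (simp add: g_def)
      also have "M * d (s (n + p)) (s (m + p)) \<le> M * (k ^ p * d (s n) (s m))"
        using contractive_shift_le[where s = s and n = n and m = m and i = p, OF contr \<open>0 \<le> k\<close>]
          \<open>1 \<le> M\<close> by (intro mult_left_mono) auto
      also have "\<dots> \<le> 1 / 2 * d (s n) (s m)"
        unfolding mult.assoc[symmetric]
        using p nonneg[OF in_X in_X] by (intro mult_right_mono) auto
      finally show ?thesis
        by (simp add: algebra_simps)
    qed
  qed

  have "g \<longlonglongrightarrow> 0"
    unfolding g_def using ran contr \<open>0 \<le> k\<close> \<open>k < 1\<close> by (rule contractive_gap_tendsto_0)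
  show ?thesis
    unfolding cauchy_seq_def
  proof (intro allI impI)
    fix \<epsilon> :: real
    assume "0 < \<epsilon>"
    then have "0 < \<epsilon> / (4 * M)"
      using \<open>1 \<le> M\<close> by simp
    then obtain K where K: "\<And>n. K \<le> n \<Longrightarrow> g n < \<epsilon> / (4 * M)"
      using order_tendstoD(2)[OF \<open>g \<longlonglongrightarrow> 0\<close>] unfolding eventually_sequentially by blast
    have "d (s n) (s m) < \<epsilon>" if "max 1 (max N K) \<le> n" "max 1 (max N K) \<le> m" for n m
    proof -
      have "g n + g m < \<epsilon> / (2 * M)"
        using K[of n] K[of m] that by simp
      then have "2 * M * (g n + g m) < \<epsilon>"
        using \<open>1 \<le> M\<close> by (simp add: field_simps)
      then show ?thesis
        using close[of n m] that by simp
    qed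
    then show "\<exists>N\<ge>1. \<forall>n\<ge>N. \<forall>m\<ge>N. d (s n) (s m) < \<epsilon>"
      by (intro exI[of _ "max 1 (max N K)"]) simp
  qed
qed

section \<open>Uniqueness of limits\<close>

text \<open>An injective sequence avoids both limits from some index on, so that two different limits and
  two consecutive terms are the corners of a rectangle, all of whose other three sides shrink.\<close>

lemma injective_limit_unique:
  assumes ran: "range s \<subseteq> X" and "inj s" and "y \<in> X" "z \<in> X"
    and lim_y: "converges_to d s y" and lim_z: "converges_to d s z"
    and gap: "(\<lambda>n. d (s n) (s (Suc n))) \<longlonglongrightarrow> 0"
    and \<alpha>_y: "(\<lambda>n. \<alpha> y (s n)) \<longlonglongrightarrow> a"
    and \<alpha>_s: "(\<lambda>n. \<alpha> (s n) (s (Suc n))) \<longlonglongrightarrow> b"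
    and \<alpha>_z: "(\<lambda>n. \<alpha> (s n) z) \<longlonglongrightarrow> c"
  shows "y = z"
proof (rule ccontr)
  assume "y \<noteq> z"
  have in_X: "s n \<in> X" for n
    using ran by auto
  have avoid: "\<forall>\<^sub>F n in sequentially. s n \<noteq> w" for w
  proof -
    have "finite (s -` {w})"
      using \<open>inj s\<close> by (simp add: finite_vimageI)
    then show ?thesis
      by (auto simp: cofinite_eq_sequentially[symmetric] eventually_cofinite vimage_def)
  qed
  let ?f = "\<lambda>n. \<alpha> y (s n) * d y (s n) + \<alpha> (s n) (s (Suc n)) * d (s n) (s (Suc n))
    + \<alpha> (s (Suc n)) z * d (s (Suc n)) z"
  have "(\<lambda>n. d y (s n)) \<longlonglongrightarrow> 0"
    using lim_y commute[OF \<open>y \<in> X\<close> in_X] by (simp add: converges_to_def)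
  moreover have "(\<lambda>n. d (s (Suc n)) z) \<longlonglongrightarrow> 0"
    using lim_z LIMSEQ_Suc by (auto simp: converges_to_def)
  ultimately have "?f \<longlonglongrightarrow> a * 0 + b * 0 + c * 0"
    using \<alpha>_y \<alpha>_s gap LIMSEQ_Suc[OF \<alpha>_z] by (intro tendsto_add tendsto_mult)
  moreover have "\<forall>\<^sub>F n in sequentially. d y z \<le> ?f n"
  proof -
    have "\<forall>\<^sub>F n in sequentially. s (Suc n) \<noteq> w" for w
      using avoid[of w] eventually_sequentially_Suc[of "\<lambda>n. s n \<noteq> w"] by blast
    from avoid[of y] avoid[of z] this[of y] this[of z] show ?thesis
    proof eventually_elim
      case (elim n)
      then show ?case
        using \<open>y \<noteq> z\<close> \<open>y \<in> X\<close> \<open>z \<in> X\<close> \<open>inj s\<close> in_X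
        by (intro rectangle) (auto simp: inj_eq)
    qed
  qed
  ultimately have "d y z \<le> a * 0 + b * 0 + c * 0"
    by (intro tendsto_lowerbound) auto
  then show False
    using nonneg[OF \<open>y \<in> X\<close> \<open>z \<in> X\<close>] zero_iff[OF \<open>y \<in> X\<close> \<open>z \<in> X\<close>] \<open>y \<noteq> z\<close> by simp
qed

end

section \<open>The fixed point theorem\<close>

theorem theorem2p7:
  fixes X :: "'a set" and \<alpha> d :: "'a \<Rightarrow> 'a \<Rightarrow> real"
    and T :: "'a \<Rightarrow> 'a" and k :: real and x0 :: 'a and x :: "nat \<Rightarrow> 'a"
  assumes "controlled_rectangular_metric X \<alpha> d"
    and "complete_space X d"
    and "T \<in> X \<rightarrow> X"
    and "0 < k" and "k < 1"
    and "\<And>u v. \<lbrakk>u \<in> X; v \<in> X; d (T v) (T u) > 0\<rbrakk> \<Longrightarrow> d (T v) (T u) \<le> k * d u v"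
    and "x0 \<in> X"
    and "\<And>n. x n = (T ^^ n) x0"
    and "\<exists>L::ereal.
      ((\<lambda>i. SUP m\<in>{1..}. ereal (\<alpha> (x (i + 1)) (x m) *
          ((\<alpha> (x (i + 1)) (x (i + 2)) + \<alpha> (x (i + 2)) (x (i + 3))) /
           (\<alpha> (x i) (x (i + 1)) + \<alpha> (x (i + 1)) (x (i + 2)))))) \<longlonglongrightarrow> L) \<and>
      L < ereal (1 / k ^ 2)"
    and "\<And>u. u \<in> X \<Longrightarrow> \<exists>l::real. (\<lambda>n. \<alpha> (x n) u) \<longlonglongrightarrow> l"
    and "\<And>u. u \<in> X \<Longrightarrow> \<exists>l::real. (\<lambda>n. \<alpha> u (x n)) \<longlonglongrightarrow> l"
    and "\<exists>l::real. ((\<lambda>(n, m). \<alpha> (x n) (x m)) \<longlongrightarrow> l) off_diagonal_at_top"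
  shows "\<exists>!z. z \<in> X \<and> T z = z"
proof -
  interpret controlled_rectangular_metric X \<alpha> d by fact
  note T_in = funcset_mem[OF \<open>T \<in> X \<rightarrow> X\<close>]
  have contraction: "d (T u) (T v) \<le> k * d u v" if "u \<in> X" "v \<in> X" for u v
  proof (cases "d (T u) (T v) > 0")
    case True
    then show ?thesis
      using assms(6)[of v u] commute[OF that] that by simp
  next
    case False
    then show ?thesis
      using mult_nonneg_nonneg[OF _ nonneg[OF that], of k] \<open>0 < k\<close> by linarith
  qed
  have x_Suc: "x (Suc n) = T (x n)" for n
    by (simp add: assms(8))
  have in_X: "x n \<in> X" for n
    by (induction n) (simp_all add: assms(8) \<open>x0 \<in> X\<close> T_in)
  then have ran: "range x \<subseteq> X" by auto
  have contr: "d (x (Suc n)) (x (Suc m)) \<le> k * d (x n) (x m)" for n m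
    unfolding x_Suc by (intro contraction in_X)

  have unique: "u = v" if "u \<in> X" "v \<in> X" "T u = u" "T v = v" for u v
  proof -
    have "(1 - k) * d u v \<le> 0"
      using contraction[of u v] that by (simp add: algebra_simps)
    then have "d u v \<le> 0"
      using \<open>k < 1\<close> by (simp add: mult_le_0_iff)
    then show ?thesis
      using nonneg[OF that(1,2)] zero_iff[OF that(1,2)] by simp
  qed

  have "\<exists>z\<in>X. T z = z"
  proof (cases "\<exists>n. x (Suc n) = x n")
    case True
    then show ?thesis
      using in_X x_Suc by metis
  next
    case False
    have "inj x \<or> (\<exists>n. x (Suc n) = x n)"
      using \<open>0 < k\<close> \<open>k < 1\<close> by (intro contractive_inj_or_stationary[OF ran contr]) (auto simp: x_Suc)
    with False have "inj x" by simp
    obtain l where l: "((\<lambda>(n, m). \<alpha> (x n) (x m)) \<longlongrightarrow> l) off_diagonal_at_top"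
      using assms(12) by blast
    then have "\<forall>\<^sub>F (n, m) in off_diagonal_at_top. \<alpha> (x n) (x m) < l + 1"
      using order_tendstoD(2)[OF l, of "l + 1"] by (simp add: case_prod_unfold)
    then obtain N where "\<And>n m. \<lbrakk>N \<le> n; N \<le> m; n \<noteq> m\<rbrakk> \<Longrightarrow> \<alpha> (x n) (x m) \<le> l + 1"
      unfolding eventually_off_diagonal_at_top by fastforce
    then have "cauchy_seq d x"
      using contractive_imp_cauchy_seq[OF ran \<open>inj x\<close> contr, of N "l + 1"] \<open>0 < k\<close> \<open>k < 1\<close> by simp
    then obtain z where "z \<in> X" and z: "converges_to d x z"
      using \<open>complete_space X d\<close> ran unfolding complete_space_def by blast
    have Tz: "converges_to d x (T z)"
    proof -
      have "(\<lambda>n. d (x (Suc n)) (T z)) \<longlonglongrightarrow> 0"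
      proof (rule tendsto_sandwich)
        show "\<forall>\<^sub>F n in sequentially. 0 \<le> d (x (Suc n)) (T z)"
          using nonneg in_X T_in \<open>z \<in> X\<close> by simp
        show "\<forall>\<^sub>F n in sequentially. d (x (Suc n)) (T z) \<le> k * d (x n) z"
          unfolding x_Suc using contraction in_X \<open>z \<in> X\<close> by simp
        show "(\<lambda>n. k * d (x n) z) \<longlonglongrightarrow> 0"
          using z unfolding converges_to_def by (rule tendsto_mult_right_zero)
      qed simp
      then show ?thesis
        unfolding converges_to_def by (rule LIMSEQ_imp_Suc)
    qed
    have gap: "(\<lambda>n. d (x n) (x (Suc n))) \<longlonglongrightarrow> 0"
      using contractive_gap_tendsto_0[OF ran contr, where p = 1] \<open>0 < k\<close> \<open>k < 1\<close> by simp
    have step: "(\<lambda>n. \<alpha> (x n) (x (Suc n))) \<longlonglongrightarrow> l"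
      using filterlim_compose[OF l filterlim_Suc_off_diagonal_at_top] by simp
    obtain a c where "(\<lambda>n. \<alpha> z (x n)) \<longlonglongrightarrow> a" "(\<lambda>n. \<alpha> (x n) (T z)) \<longlonglongrightarrow> c"
      using assms(10,11) T_in \<open>z \<in> X\<close> by meson
    then have "z = T z"
      using injective_limit_unique[OF ran \<open>inj x\<close> \<open>z \<in> X\<close> T_in[OF \<open>z \<in> X\<close>] z Tz gap _ step]
      by blast
    then show ?thesis
      using \<open>z \<in> X\<close> by metis
  qed
  then show ?thesis
    using unique by blast
qed

end
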